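(* Let $r\ge 1$ be an integer and let $(F^{(r)}_k)_{k\in\mathbb{Z}}$ be the $r$-th generation hyperfibonacci sequence, extended to all integer indices as described in the context. For an integer $n$, let $A_{r,n}$ be the $(r+2)\times(r+2)$ matrix with entries $(A_{r,n})_{i,j}=F^{(r)}_{n+i+j-2}$, $1\le i,j\le r+2$. Then for every $n\in\mathbb{Z}$, $$\det(A_{r,n})=(-1)^{\,n+\lfloor (r+3)/2\rfloor}.$$
   Context: Let $(F_k)_{k\ge0}$ be the Fibonacci numbers, $F_0=0$, $F_1=1$, $F_{k+2}=F_{k+1}+F_k$. The hyperfibonacci numbers are defined for $k\ge 0$ by $F^{(0)}_k=F_k$ and, for $r\ge1$, $F^{(r)}_k=\sum_{j=0}^{k}F^{(r-1)}_j$ (so $F^{(r)}_0=0$, $F^{(r)}_1=1$). For fixed $r\ge1$ these satisfy, for $k\ge0$, $F^{(r)}_{k+2}=F^{(r)}_{k+1}+F^{(r)}_k+\binom{k+r}{r-1}$; the sequence is extended to negative indices as the unique two-sided sequence satisfying this recurrence for all $k\in\mathbb{Z}$, where $\binom{k+r}{r-1}$ is interpreted as the polynomial $\frac{(k+r)(k+r-1)\cdots(k+2)}{(r-1)!}$ in $k$ (equal to $1$ when $r=1$). (In particular $F^{(r)}_{k}=0$ for $-r\le k\le 0$.) *)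

theory Defs
  imports
    "HOL-Number_Theory.Fib"
    "Jordan_Normal_Form.Determinant"
begin

fun hyperfib :: "nat \<Rightarrow> nat \<Rightarrow> nat" where
  "hyperfib 0 k = fib k"
| "hyperfib (Suc r) k = (\<Sum>j=0..k. hyperfib r j)"

text \<open>
  Over \<^typ>\<open>rat\<close>, the binomial \<open>(k + r) gchoose (r - 1)\<close> is the polynomial
  \<open>(k + r) (k + r - 1) \<cdots> (k + 2) / (r - 1)!\<close> in \<open>k\<close>, also for negative \<open>k\<close>.
  The notion is meant for \<open>r \<ge> 1\<close> only.
\<close>

definition hyperfib_extension :: "nat \<Rightarrow> (int \<Rightarrow> int) \<Rightarrow> bool" where
  "hyperfib_extension r F \<longleftrightarrow>
     (\<forall>k::nat. F (int k) = int (hyperfib r k)) \<and>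
     (\<forall>k::int. rat_of_int (F (k + 2)) =
        rat_of_int (F (k + 1)) + rat_of_int (F k) + (rat_of_int (k + int r) gchoose (r - 1)))"

definition hyperfib_int :: "nat \<Rightarrow> int \<Rightarrow> int" where
  "hyperfib_int r = (THE F. hyperfib_extension r F)"

text \<open>
  Rows and columns are indexed from \<open>0\<close>, so the entry \<open>n + i + j - 2\<close>
  of the usual indexing from \<open>1\<close> becomes \<open>n + i + j\<close>.
\<close>

definition hyperfib_mat :: "nat \<Rightarrow> int \<Rightarrow> int mat" where
  "hyperfib_mat r n = mat (r + 2) (r + 2) (\<lambda>(i, j). hyperfib_int r (n + int i + int j))"

lemma hyperfib_0 [simp]: "hyperfib r 0 = 0"
  by (induction r) auto

lemma hyperfib_1 [simp]: "hyperfib r (Suc 0) = 1"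
  by (induction r) auto

lemma hyperfib_Suc_Suc: "hyperfib (Suc r) (Suc k) = hyperfib (Suc r) k + hyperfib r (Suc k)"
  by simp

lemma hyperfib_2: "hyperfib r (Suc (Suc 0)) = Suc r"
  by (induction r) (auto simp: numeral_2_eq_2)

lemma hyperfib_rec:
  "hyperfib (Suc r) (Suc (Suc k)) =
     hyperfib (Suc r) (Suc k) + hyperfib (Suc r) k + (k + Suc r choose r)"
proof (induction r arbitrary: k)
  case 0
  show ?case
  proof (induction k)
    case (Suc k)
    then show ?case
      by (simp add: hyperfib_Suc_Suc del: hyperfib.simps(2))
  qed (simp add: numeral_2_eq_2)
next
  case (Suc r)
  note rec = Suc.IH
  show ?case
  proof (induction k)
    case 0
    show ?case
      by (simp add: hyperfib_2 del: hyperfib.simps)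
  next
    case (Suc k)
    have "hyperfib (Suc (Suc r)) (Suc (Suc (Suc k))) =
        hyperfib (Suc (Suc r)) (Suc (Suc k)) + hyperfib (Suc r) (Suc (Suc (Suc k)))"
      by (rule hyperfib_Suc_Suc)
    moreover have "hyperfib (Suc (Suc r)) (Suc (Suc k)) =
        hyperfib (Suc (Suc r)) (Suc k) + hyperfib (Suc r) (Suc (Suc k))"
      by (rule hyperfib_Suc_Suc)
    moreover have "hyperfib (Suc (Suc r)) (Suc k) =
        hyperfib (Suc (Suc r)) k + hyperfib (Suc r) (Suc k)"
      by (rule hyperfib_Suc_Suc)
    moreover have "(Suc k + Suc (Suc r) choose Suc r) =
        (k + Suc (Suc r) choose Suc r) + (Suc k + Suc r choose r)"
      by simp
    ultimately show ?case
      using Suc.IH rec[of "Suc k"] by linarith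
  qed
qed

lemma hyperfib_extension_iff:
  assumes c: "\<And>k. rat_of_int (c k) = rat_of_int (k + int r) gchoose (r - 1)"
  shows "hyperfib_extension r F \<longleftrightarrow>
     (\<forall>k::nat. F (int k) = int (hyperfib r k)) \<and> (\<forall>k. F (k + 2) = F (k + 1) + F k + c k)"
  unfolding hyperfib_extension_def c[symmetric] of_int_add[symmetric] of_int_eq_iff ..

lemma obtain_hyperfib_binomial:
  obtains c :: "int \<Rightarrow> int"
  where "\<And>k. rat_of_int (c k) = rat_of_int (k + int r) gchoose (r - 1)"
proof -
  have "\<exists>z. rat_of_int z = rat_of_int (k + int r) gchoose (r - 1)" for k
    by (rule exI, rule of_int_gbinomial)
  then show ?thesis
    using that by metis
qed

lemma hyperfib_extension_unique:
  assumes F: "hyperfib_extension r F" and G: "hyperfib_extension r G"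
  shows "F = G"
proof -
  obtain c where c: "\<And>k. rat_of_int (c k) = rat_of_int (k + int r) gchoose (r - 1)"
    using obtain_hyperfib_binomial by blast
  note ext = hyperfib_extension_iff[of c, OF c]
  have "F (- int m) = G (- int m) \<and> F (1 - int m) = G (1 - int m)" for m
  proof (induction m)
    case 0
    have "F (int k) = G (int k)" for k
      using F G by (simp add: ext)
    from this[of 0] this[of 1] show ?case
      by simp
  next
    case (Suc m)
    have "F (- int m - 1 + 2) = F (- int m - 1 + 1) + F (- int m - 1) + c (- int m - 1)"
      using F unfolding ext by blast
    moreover have "G (- int m - 1 + 2) = G (- int m - 1 + 1) + G (- int m - 1) + c (- int m - 1)"
      using G unfolding ext by blast
    moreover have "- int m - 1 = - int (Suc m)" "1 - int (Suc m) = - int m"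
      "- int m - 1 + 2 = 1 - int m" "- int m - 1 + 1 = - int m"
      by simp_all
    ultimately show ?case
      using Suc.IH by (simp only:) linarith
  qed
  moreover have "F (int m) = G (int m)" for m
    using F G by (simp add: ext)
  ultimately have "F k = G k" for k
    by (cases k rule: int_cases2) simp_all
  then show ?thesis
    by (rule HOL.ext)
qed

lemma hyperfib_extension_exists:
  assumes "r \<ge> 1"
  shows "\<exists>F. hyperfib_extension r F"
proof -
  obtain c where c: "\<And>k. rat_of_int (c k) = rat_of_int (k + int r) gchoose (r - 1)"
    using obtain_hyperfib_binomial by blast
  define P where
    "P = rec_nat (0 :: int, 1 :: int) (\<lambda>m p. (snd p - fst p - c (- int m - 1), fst p))"
  define F where "F = (\<lambda>k. if k \<ge> 0 then int (hyperfib r (nat k)) else fst (P (nat (- k))))"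
  have P_0: "P 0 = (0, 1)"
    by (simp add: P_def)
  have P_Suc: "P (Suc m) = (snd (P m) - fst (P m) - c (- int m - 1), fst (P m))" for m
    by (simp add: P_def)
  have F_P: "F (- int m) = fst (P m)" for m
    by (cases "m = 0") (simp_all add: F_def P_0)
  have F_P': "F (1 - int m) = snd (P m)" for m
  proof (cases m)
    case 0
    then show ?thesis
      by (simp add: F_def P_0)
  next
    case (Suc l)
    then show ?thesis
      using F_P[of l] by (simp add: P_Suc)
  qed
  have "F (k + 2) = F (k + 1) + F k + c k" for k
  proof (cases "k \<ge> 0")
    case True
    then obtain m where m: "k = int m"
      by (metis nonneg_int_cases)
    obtain s where s: "r = Suc s"
      using assms by (cases r) auto
    have "rat_of_int (c k) = rat_of_nat (m + Suc s) gchoose s"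
      unfolding c m s by (simp add: algebra_simps)
    then have "rat_of_int (c k) = rat_of_int (int (m + Suc s choose s))"
      unfolding binomial_gbinomial[symmetric] by simp
    then have "c k = int (m + Suc s choose s)"
      unfolding of_int_eq_iff .
    moreover have "nat (int m + 2) = Suc (Suc m)" "nat (int m + 1) = Suc m"
      by auto
    ultimately show ?thesis
      using hyperfib_rec[of s m] by (simp add: F_def m s del: hyperfib.simps)
  next
    case False
    define m where "m = nat (- k - 1)"
    have k: "k = - int (Suc m)"
      using False by (simp add: m_def)
    have idx: "k + 2 = 1 - int m" "k + 1 = - int m" "- int m - 1 = k"
      by (simp_all add: k)
    have "F k = F (k + 2) - F (k + 1) - c k"
      using F_P[of "Suc m"] unfolding idx k[symmetric] P_Suc F_P F_P' by simp
    then show ?thesis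
      by simp
  qed
  then have "hyperfib_extension r F"
    by (simp add: hyperfib_extension_iff[of c, OF c] F_def)
  then show ?thesis
    by (rule exI[of _ F])
qed

lemma hyperfib_extension_hyperfib_int:
  assumes "r \<ge> 1"
  shows "hyperfib_extension r (hyperfib_int r)"
proof -
  obtain F where F: "hyperfib_extension r F"
    using hyperfib_extension_exists[OF assms] by (rule exE)
  show ?thesis
    unfolding hyperfib_int_def
    using F hyperfib_extension_unique[OF _ F] by (rule theI[of "hyperfib_extension r"])
qed

end

theory Submission
  imports Defs
begin

text \<open>
  Applying the difference operator \<open>r\<close> times removes the binomial term and leaves a
  Fibonacci recurrence, so the hyperfibonacci numbers satisfy a homogeneous linear recurrence of
  order \<open>r + 2\<close> whose lowest coefficient is \<open>(-1)^r\<close>. Multiplication by its companion matrix,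
  of determinant \<open>-1\<close>, moves the Hankel matrix from \<open>n\<close> to \<open>n + 1\<close>. At \<open>n = - r\<close> the zeros
  of the sequence make the Hankel matrix triangular with respect to the antidiagonal.
\<close>

section \<open>Hankel matrices and homogeneous recurrences\<close>

definition hankel_mat :: "nat \<Rightarrow> (int \<Rightarrow> 'a) \<Rightarrow> int \<Rightarrow> 'a mat" where
  "hankel_mat d f n = mat d d (\<lambda>(i, j). f (n + int i + int j))"

text \<open>The coefficients fill the last row, so that left multiplication moves rows up by one and
  computes the new last row from the recurrence.\<close>

definition companion_row_mat :: "nat \<Rightarrow> (nat \<Rightarrow> 'a) \<Rightarrow> 'a :: zero_neq_one mat" where
  "companion_row_mat d c =
     mat d d (\<lambda>(i, j). if Suc i = d then c j else if j = Suc i then 1 else 0)"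

definition linear_recurrence :: "nat \<Rightarrow> (nat \<Rightarrow> 'a) \<Rightarrow> (int \<Rightarrow> 'a :: comm_ring_1) \<Rightarrow> bool" where
  "linear_recurrence d c f \<longleftrightarrow> (\<forall>k. f (k + int d) = (\<Sum>j<d. c j * f (k + int j)))"

text \<open>Undoing a difference multiplies the characteristic polynomial by \<open>X - 1\<close>,
  which flips the sign of the constant coefficient.\<close>

lemma linear_recurrence_of_difference:
  fixes f :: "int \<Rightarrow> 'a :: comm_ring_1"
  assumes "linear_recurrence (Suc d) c (\<lambda>k. f (k + 1) - f k)"
  shows "\<exists>c'. c' 0 = - c 0 \<and> linear_recurrence (Suc (Suc d)) c' f"
proof -
  \<comment> \<open>The summands come from \<open>f (k + int (Suc d))\<close> moved to the
    right-hand side, from the terms \<open>c j * f (k + int (Suc j))\<close>, and from the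
    subtracted \<open>c j * f (k + int j)\<close>.\<close>
  define c' where "c' = (\<lambda>j. (if j = Suc d then 1 else 0) +
    (case j of 0 \<Rightarrow> 0 | Suc i \<Rightarrow> c i) - (if j < Suc d then c j else 0))"
  have "f (k + int (Suc (Suc d))) = (\<Sum>j<Suc (Suc d). c' j * f (k + int j))" for k
  proof -
    have "f (k + int (Suc (Suc d))) - f (k + int (Suc d)) =
        (\<Sum>j<Suc d. c j * (f (k + int (Suc j)) - f (k + int j)))"
      using assms[unfolded linear_recurrence_def, rule_format, of k] by (simp add: algebra_simps)
    moreover have "(\<Sum>j<Suc (Suc d). (if j = Suc d then 1 else 0) * f (k + int j)) =
        f (k + int (Suc d))"
      by simp
    moreover have "(\<Sum>j<Suc (Suc d). (case j of 0 \<Rightarrow> 0 | Suc i \<Rightarrow> c i) * f (k + int j)) =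
        (\<Sum>j<Suc d. c j * f (k + int (Suc j)))"
      by (subst sum.lessThan_Suc_shift) simp
    moreover have "(\<Sum>j<Suc (Suc d). (if j < Suc d then c j else 0) * f (k + int j)) =
        (\<Sum>j<Suc d. c j * f (k + int j))"
      by simp
    ultimately show ?thesis
      unfolding c'_def ring_distribs sum.distrib sum_subtractf by (simp add: algebra_simps)
  qed
  moreover have "c' 0 = - c 0"
    by (simp add: c'_def)
  ultimately show ?thesis
    unfolding linear_recurrence_def by blast
qed

lemma linear_recurrence_fibonacci:
  assumes "\<And>k. f (k + 2) = f (k + 1) + f k"
  shows "linear_recurrence 2 (\<lambda>_. 1) f"
  using assms by (simp add: linear_recurrence_def numeral_2_eq_2 add.commute)

text \<open>By Pascal's rule one difference lowers the index \<open>s\<close> and keeps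
  \<open>a\<close>. After \<open>s + 1\<close> differences the binomial is gone and the Fibonacci
  recurrence with \<open>c 0 = 1\<close> remains; each of them contributes a factor
  \<open>-1\<close> to \<open>c 0\<close>.\<close>

lemma linear_recurrence_fibonacci_gbinomial:
  fixes f :: "int \<Rightarrow> 'a :: field_char_0"
  assumes "\<And>k. f (k + 2) = f (k + 1) + f k + ((of_int k + a) gchoose s)"
  shows "\<exists>c. c 0 = (- 1) ^ Suc s \<and> linear_recurrence (s + 3) c f"
  using assms
proof (induction s arbitrary: f)
  case 0
  have "f (k + 2 + 1) - f (k + 2) = f (k + 1 + 1) - f (k + 1) + (f (k + 1) - f k)" for k
    using 0[of k] 0[of "k + 1"] by (simp add: algebra_simps)
  then have "linear_recurrence (Suc 1) (\<lambda>_. 1) (\<lambda>k. f (k + 1) - f k)"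
    using linear_recurrence_fibonacci[of "\<lambda>k. f (k + 1) - f k"] by (simp only: numeral_2_eq_2 One_nat_def)
  from linear_recurrence_of_difference[OF this] show ?case
    by (simp add: numeral_3_eq_3)
next
  case (Suc s)
  have "\<exists>c. c 0 = (- 1) ^ Suc s \<and> linear_recurrence (s + 3) c (\<lambda>k. f (k + 1) - f k)"
  proof (rule Suc.IH)
    fix k
    have "(of_int (k + 1) + a) gchoose Suc s =
        ((of_int k + a) gchoose s) + ((of_int k + a) gchoose Suc s)"
      using gbinomial_Suc_Suc[of "of_int k + a" s] by (simp add: algebra_simps)
    then show "f (k + 2 + 1) - f (k + 2) =
        f (k + 1 + 1) - f (k + 1) + (f (k + 1) - f k) + ((of_int k + a) gchoose s)"
      using Suc.prems[of k] Suc.prems[of "k + 1"] by (simp add: algebra_simps)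
  qed
  then obtain c where "c 0 = (- 1) ^ Suc s"
    "linear_recurrence (Suc (s + 2)) c (\<lambda>k. f (k + 1) - f k)"
    by (auto simp: numeral_3_eq_3 numeral_2_eq_2)
  with linear_recurrence_of_difference[OF this(2)] show ?case
    by (auto simp: numeral_3_eq_3 numeral_2_eq_2)
qed

section \<open>Determinants of companion, Hankel and antitriangular matrices\<close>

lemma det_companion_row_mat:
  "det (companion_row_mat (Suc d) c) = (- 1) ^ d * (c 0 :: 'a :: comm_ring_1)"
proof -
  let ?C = "companion_row_mat (Suc d) c"
  have C: "?C \<in> carrier_mat (Suc d) (Suc d)"
    by (simp add: companion_row_mat_def)
  \<comment> \<open>Column 0 is zero above its bottom entry \<open>c 0\<close>, so the Laplace
    expansion has the single minor computed here.\<close>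
  have "mat_delete ?C d 0 = 1\<^sub>m d"
    by (rule eq_matI) (auto simp: mat_delete_def companion_row_mat_def)
  moreover have "det ?C = (\<Sum>i<Suc d. ?C $$ (i, 0) * cofactor ?C i 0)"
    using laplace_expansion_column[OF C, of 0] by simp
  moreover have "?C $$ (i, 0) = 0" if "i < d" for i
    using that by (simp add: companion_row_mat_def)
  moreover have "?C $$ (d, 0) = c 0"
    by (simp add: companion_row_mat_def)
  ultimately show ?thesis
    by (simp add: cofactor_def mult.commute)
qed

lemma companion_row_mat_mult_hankel_mat:
  assumes "linear_recurrence d c f"
  shows "companion_row_mat d c * hankel_mat d f n = hankel_mat d f (n + 1)"
proof (rule eq_matI)
  fix i j
  assume "i < dim_row (hankel_mat d f (n + 1))" "j < dim_col (hankel_mat d f (n + 1))"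
  then have ij: "i < d" "j < d"
    by (simp_all add: hankel_mat_def)
  have entry: "(companion_row_mat d c * hankel_mat d f n) $$ (i, j) =
      (\<Sum>l<d. (if Suc i = d then c l else if l = Suc i then 1 else 0) * f (n + int l + int j))"
    using ij by (simp add: companion_row_mat_def hankel_mat_def scalar_prod_def lessThan_atLeast0)
  have "\<dots> = f (n + 1 + int i + int j)"
  proof (cases "Suc i = d")
    case True
    \<comment> \<open>The last row is the recurrence taken at \<open>n + int j\<close>.\<close>
    then have "(\<Sum>l<d. c l * f (n + int j + int l)) = f (n + int j + int (Suc i))"
      using assms by (simp add: linear_recurrence_def)
    then show ?thesis
      using True by (auto simp: algebra_simps)
  next
    case False
    then have "Suc i < d"
      using ij by simp
    then show ?thesis
      using False by (simp add: algebra_simps if_distrib[of "\<lambda>x. x * _"] cong: if_cong)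
  qed
  then show "(companion_row_mat d c * hankel_mat d f n) $$ (i, j) =
      hankel_mat d f (n + 1) $$ (i, j)"
    unfolding entry using ij by (simp add: hankel_mat_def)
qed (simp_all add: companion_row_mat_def hankel_mat_def)

lemma det_hankel_mat_shift:
  fixes f :: "int \<Rightarrow> 'a :: comm_ring_1"
  assumes "linear_recurrence (Suc d) c f"
  shows "det (hankel_mat (Suc d) f (n + 1)) = (- 1) ^ d * c 0 * det (hankel_mat (Suc d) f n)"
  unfolding companion_row_mat_mult_hankel_mat[OF assms, symmetric] det_companion_row_mat[symmetric]
  by (rule det_mult[of _ "Suc d"]) (simp_all add: companion_row_mat_def hankel_mat_def)

text \<open>The first row has only its last entry, and the remaining minor has the same shape. The
  result is the sign of the reversal permutation, a product of \<open>d div 2\<close>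
  transpositions.\<close>

lemma det_antitriangular:
  fixes A :: "'a :: comm_ring_1 mat"
  assumes "A \<in> carrier_mat d d"
    and "\<And>i j. i + j < d - 1 \<Longrightarrow> A $$ (i, j) = 0"
    and "\<And>i j. Suc (i + j) = d \<Longrightarrow> A $$ (i, j) = 1"
  shows "det A = (- 1) ^ (d div 2)"
  using assms
proof (induction d arbitrary: A)
  case 0
  then show ?case
    by simp
next
  case (Suc d)
  have "det (mat_delete A 0 d) = (- 1) ^ (d div 2)"
    using Suc.prems by (intro Suc.IH) (auto simp: mat_delete_def)
  moreover have "det A = (\<Sum>j<Suc d. A $$ (0, j) * cofactor A 0 j)"
    using laplace_expansion_row[OF Suc.prems(1), of 0] by simp
  moreover have "A $$ (0, j) = 0" if "j < d" for j
    using Suc.prems(2)[of 0 j] that by simp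
  moreover have "A $$ (0, d) = 1"
    using Suc.prems(3) by simp
  ultimately have "det A = (- 1) ^ (d + d div 2)"
    by (simp add: cofactor_def power_add)
  also have "\<dots> = (- 1) ^ (Suc d div 2)"
  proof -
    have "even (d + d div 2) \<longleftrightarrow> even (Suc d div 2)"
      by presburger
    then show ?thesis
      by (simp add: minus_one_power_iff)
  qed
  finally show ?case .
qed

section \<open>Hankel determinants of the hyperfibonacci numbers\<close>

lemma hyperfib_int_rec:
  assumes "r \<ge> 1"
  shows "rat_of_int (hyperfib_int r (k + 2)) = rat_of_int (hyperfib_int r (k + 1)) +
    rat_of_int (hyperfib_int r k) + ((rat_of_int k + of_nat r) gchoose (r - 1))"
  using hyperfib_extension_hyperfib_int[OF assms] by (simp add: hyperfib_extension_def)

lemma hyperfib_int_of_nat: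
  assumes "r \<ge> 1"
  shows "hyperfib_int r (int k) = int (hyperfib r k)"
  using hyperfib_extension_hyperfib_int[OF assms] by (simp add: hyperfib_extension_def)

lemma hyperfib_int_0:
  assumes "r \<ge> 1"
  shows "hyperfib_int r 0 = 0"
  using hyperfib_int_of_nat[OF assms, of 0] by simp

lemma hyperfib_int_1:
  assumes "r \<ge> 1"
  shows "hyperfib_int r 1 = 1"
  using hyperfib_int_of_nat[OF assms, of 1] by simp

lemma hyperfib_int_uminus_eq_0:
  assumes r: "r \<ge> 1"
  shows "m \<le> r \<Longrightarrow> hyperfib_int r (- int m) = 0"
proof (induction m rule: less_induct)
  case (less m)
  consider "m = 0" | "m = 1" | l where "m = Suc (Suc l)"
    by (metis One_nat_def nat.exhaust)
  then show ?case
  proof cases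
    case 1
    then show ?thesis
      using hyperfib_int_0[OF r] by simp
  next
    case 2
    \<comment> \<open>At index \<open>-1\<close> the binomial is 1 and accounts for all of
      \<open>hyperfib_int r 1\<close>, leaving 0 for the value at \<open>-1\<close>.\<close>
    have "rat_of_int (- 1) + rat_of_nat r = rat_of_nat (r - 1)"
      using r by (simp add: of_nat_diff)
    then have "(rat_of_int (- 1) + rat_of_nat r) gchoose (r - 1) = 1"
      by (simp only: binomial_gbinomial[symmetric] binomial_n_n of_nat_1)
    then show ?thesis
      using hyperfib_int_rec[OF r, of "- 1"] 2 hyperfib_int_0[OF r] hyperfib_int_1[OF r]
      by simp
  next
    case (3 l)
    \<comment> \<open>Since \<open>2 \<le> m \<le> r\<close>, the upper argument is a natural number
      below \<open>r - 1\<close>, so the binomial vanishes and the recurrence carries two zeros one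
      index further down.\<close>
    have "rat_of_int (- int m) + rat_of_nat r = rat_of_nat (r - m)"
      using less.prems by (simp add: of_nat_diff)
    then have "(rat_of_int (- int m) + rat_of_nat r) gchoose (r - 1) = 0"
      using 3 less.prems
      by (simp only: binomial_gbinomial[symmetric] of_nat_eq_0_iff binomial_eq_0_iff)
    moreover have "hyperfib_int r (- int m + 2) = 0" "hyperfib_int r (- int m + 1) = 0"
      using less.IH[of l] less.IH[of "Suc l"] 3 less.prems by simp_all
    ultimately show ?thesis
      using hyperfib_int_rec[OF r, of "- int m"] by simp
  qed
qed

lemma det_hyperfib_mat_shift:
  assumes r: "r \<ge> 1"
  shows "det (hyperfib_mat r (n + 1)) = - det (hyperfib_mat r n)"
proof -
  obtain s where s: "r = Suc s"
    using r by (cases r) auto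
  let ?f = "\<lambda>k. rat_of_int (hyperfib_int r k)"
  obtain c where c: "c 0 = (- 1) ^ r" "linear_recurrence (Suc (Suc r)) c ?f"
    using linear_recurrence_fibonacci_gbinomial[of ?f "of_nat r" s] hyperfib_int_rec[OF r] s
    by (auto simp: numeral_3_eq_3)
  \<comment> \<open>The recurrence was derived over a field, so the integer determinant is compared
    with its image in the rationals.\<close>
  have hom: "rat_of_int (det (hyperfib_mat r m)) = det (hankel_mat (Suc (Suc r)) ?f m)" for m
  proof -
    have "map_mat rat_of_int (hyperfib_mat r m) = hankel_mat (Suc (Suc r)) ?f m"
      by (rule eq_matI) (auto simp: hyperfib_mat_def hankel_mat_def)
    then show ?thesis
      by (metis of_int_hom.hom_det)
  qed
  \<comment> \<open>The companion determinant is
    \<open>(- 1) ^ (r + 1) * (- 1) ^ r = - 1\<close>.\<close>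
  have "rat_of_int (det (hyperfib_mat r (n + 1))) = rat_of_int (- det (hyperfib_mat r n))"
    using det_hankel_mat_shift[OF c(2), of n]
    by (simp add: hom c(1) flip: power_add)
  then show ?thesis
    unfolding of_int_eq_iff .
qed

lemma det_hyperfib_mat_uminus:
  assumes r: "r \<ge> 1"
  shows "det (hyperfib_mat r (- int r)) = (- 1) ^ (Suc (Suc r) div 2)"
proof (rule det_antitriangular)
  fix i j
  assume "i + j < Suc (Suc r) - 1"
  then show "hyperfib_mat r (- int r) $$ (i, j) = 0"
    \<comment> \<open>Above the antidiagonal \<open>i + j \<le> r\<close>, so the index
      \<open>- r + i + j\<close> lies between \<open>- r\<close> and 0; on the antidiagonal it is
      1.\<close>
    using hyperfib_int_uminus_eq_0[OF r, of "r - (i + j)"]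
    by (simp add: hyperfib_mat_def of_nat_diff algebra_simps)
next
  fix i j
  assume "Suc (i + j) = Suc (Suc r)"
  then have "i < r + 2" "j < r + 2" "- int r + int i + int j = 1"
    by linarith+
  then show "hyperfib_mat r (- int r) $$ (i, j) = 1"
    using hyperfib_int_1[OF r] by (simp add: hyperfib_mat_def)
qed (simp add: hyperfib_mat_def)

theorem theorem2:
  fixes r :: nat and n :: int
  assumes "r \<ge> 1"
  shows "rat_of_int (det (hyperfib_mat r n)) = (-1) powi (n + \<lfloor>(of_nat r + 3) / (2 :: rat)\<rfloor>)"
proof -
  have floor: "\<lfloor>(of_nat r + 3) / (2 :: rat)\<rfloor> = (int r + 3) div 2"
    using floor_divide_of_int_eq[of "int r + 3" 2, where ?'a = rat] by simp
  show ?thesis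
    unfolding floor
  \<comment> \<open>The sign change between \<open>n\<close> and \<open>n + 1\<close> can be read in
    both directions, so the value at \<open>- int r\<close> determines all others.\<close>
  proof (induction n rule: int_induct[where k = "- int r"])
    case base
    have "even (- int r + (int r + 3) div 2) \<longleftrightarrow> even (Suc (Suc r) div 2)"
      by presburger
    then show ?case
      unfolding det_hyperfib_mat_uminus[OF assms]
      by (cases "even (Suc (Suc r) div 2)") simp_all
  next
    case (step1 n)
    then show ?case
      using det_hyperfib_mat_shift[OF assms, of n]
      by (simp add: power_int_add algebra_simps)
  next
    case (step2 n)
    then show ?case
      using det_hyperfib_mat_shift[OF assms, of "n - 1"]
      by (simp add: power_int_add power_int_diff algebra_simps)
  qed
qed

end
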